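(* The robust dynamic compliance constraint and the free-vibration eigenvalue constraint are equivalent up to a reparametrization, in the following sense. (i) Let $\omega>0$, $\overline{d}_{\mathrm R}>0$ and $\mathbf{Q}\in\mathbb{R}^{n_{\mathrm{dof}}\times q}$. Put $\underline{\lambda}=\omega^2$ and $\tilde{\mathbf{M}}_0=\mathbf{M}^{(0)}+\frac{1}{\omega^2\overline{d}_{\mathrm R}}\mathbf{Q}\mathbf{Q}^{\mathsf T}$. Then for every $\mathbf{a}\in\mathbb{R}^{n_{\mathrm e}}_{\ge0}$, $$\begin{pmatrix}\overline{d}_{\mathrm R}\mathbf{I}_q & -\mathbf{Q}^{\mathsf T}\\ -\mathbf{Q} & \mathbf{K}(\mathbf{a})-\omega^2\mathbf{M}(\mathbf{a})\end{pmatrix}\succeq\mathbf{0}\iff \mathbf{K}(\mathbf{a})-\underline{\lambda}\Big[\tilde{\mathbf{M}}_0+\sum_{e=1}^{n_{\mathrm e}}a_e\mathbf{M}^{(1)}_e\Big]\succeq\mathbf{0}.$$ (ii) Conversely, let $\underline{\lambda}>0$ and let $\mathbf{M}^{(0)}=\hat{\mathbf{Q}}\hat{\mathbf{Q}}^{\mathsf T}$ with $\hat{\mathbf{Q}}\in\mathbb{R}^{n_{\mathrm{dof}}\times q}$. Then for every $\mathbf{a}\in\mathbb{R}^{n_{\mathrm e}}_{\ge0}$, $$\mathbf{K}(\mathbf{a})-\underline{\lambda}\mathbf{M}(\mathbf{a})\succeq\mathbf{0}\iff\begin{pmatrix}\frac{1}{\underline{\lambda}}\mathbf{I}_q & -\hat{\mathbf{Q}}^{\mathsf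 T}\\ -\hat{\mathbf{Q}} & \mathbf{K}(\mathbf{a})-\underline{\lambda}\sum_{e=1}^{n_{\mathrm e}}a_e\mathbf{M}^{(1)}_e\end{pmatrix}\succeq\mathbf{0},$$ where the right-hand side is a robust dynamic compliance constraint with $\omega=\sqrt{\underline{\lambda}}$, load matrix $\hat{\mathbf{Q}}$, bound $1/\underline{\lambda}$, and no nonstructural mass.
   Context: For $\mathbf{a}\in\mathbb{R}^{n_{\mathrm e}}_{\ge 0}$ the stiffness and mass matrices are $\mathbf{K}(\mathbf{a})=\sum_{e=1}^{n_{\mathrm e}}\big[a_e\mathbf{K}^{(1)}_e+a_e^2\mathbf{K}^{(2)}_e+a_e^3\mathbf{K}^{(3)}_e\big]$ and $\mathbf{M}(\mathbf{a})=\mathbf{M}^{(0)}+\sum_{e=1}^{n_{\mathrm e}}a_e\mathbf{M}^{(1)}_e$, where all $\mathbf{K}^{(i)}_e$, $\mathbf{M}^{(0)}$ (the design-independent, nonstructural mass), $\mathbf{M}^{(1)}_e$ are fixed real symmetric positive semidefinite $n_{\mathrm{dof}}\times n_{\mathrm{dof}}$ matrices. The robust dynamic compliance constraint with frequency $\omega$, load matrix $\mathbf{Q}$ and bound $\overline{d}_{\mathrm R}$ is the block matrix inequality on the left of (i); the free-vibration eigenvalue constraint with bound $\underline{\lambda}$ is $\mathbf{K}(\mathbf{a})-\underline{\lambda}\mathbf{M}(\mathbf{a})\succeq\mathbf{0}$. $\mathbf{A}\succeq\mathbf{0}$ means that the real symmetric matrix $\mathbf{A}$ is positive semidefinite, and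 $\mathbf{I}_q$ is the $q\times q$ identity. *)

theory Defs
  imports "HOL-Analysis.Analysis"
begin

definition psd :: "real ^ 'n ^ 'n \<Rightarrow> bool" where
  "psd A \<longleftrightarrow> transpose A = A \<and> (\<forall>x. 0 \<le> x \<bullet> (A *v x))"

text \<open>The block matrix with first block row \<open>A B\<close> and second block row \<open>C D\<close>. Rows and columns
  are indexed by sum types; \<open>real ^ 'n ^ 'm\<close> has \<open>'m\<close> rows and \<open>'n\<close> columns.\<close>

definition block_matrix ::
  "real ^ 'n ^ 'm \<Rightarrow> real ^ 'l ^ 'm \<Rightarrow> real ^ 'n ^ 'k \<Rightarrow> real ^ 'l ^ 'k \<Rightarrow> real ^ ('n + 'l) ^ ('m + 'k)"
where
  "block_matrix A B C D =
     (\<chi> i j. case i of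
        Inl r \<Rightarrow> (case j of Inl c \<Rightarrow> A $ r $ c | Inr c \<Rightarrow> B $ r $ c)
      | Inr r \<Rightarrow> (case j of Inl c \<Rightarrow> C $ r $ c | Inr c \<Rightarrow> D $ r $ c))"

definition stiffness ::
  "('e::finite \<Rightarrow> real ^ 'n ^ 'n) \<Rightarrow> ('e \<Rightarrow> real ^ 'n ^ 'n) \<Rightarrow> ('e \<Rightarrow> real ^ 'n ^ 'n)
    \<Rightarrow> real ^ 'e \<Rightarrow> real ^ 'n ^ 'n"
where
  "stiffness K1 K2 K3 a =
     (\<Sum>e\<in>UNIV. (a $ e) *\<^sub>R K1 e + (a $ e)\<^sup>2 *\<^sub>R K2 e + (a $ e) ^ 3 *\<^sub>R K3 e)"

definition mass ::
  "real ^ 'n ^ 'n \<Rightarrow> ('e::finite \<Rightarrow> real ^ 'n ^ 'n) \<Rightarrow> real ^ 'e \<Rightarrow> real ^ 'n ^ 'n"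
where
  "mass M0 M1 a = M0 + (\<Sum>e\<in>UNIV. (a $ e) *\<^sub>R M1 e)"

text \<open>In the next two definitions \<open>K\<close> and \<open>M\<close> stand for the values of the stiffness and mass
  matrices at a given design.\<close>

definition robust_compliance_matrix ::
  "real ^ 'n ^ 'n \<Rightarrow> real ^ 'n ^ 'n \<Rightarrow> real \<Rightarrow> real ^ 'q ^ 'n \<Rightarrow> real \<Rightarrow> real ^ ('q + 'n) ^ ('q + 'n)"
where
  "robust_compliance_matrix K M \<omega> Q d =
     block_matrix (d *\<^sub>R mat 1) (- transpose Q) (- Q) (K - \<omega>\<^sup>2 *\<^sub>R M)"

definition free_vibration_constraint ::
  "real ^ 'n ^ 'n \<Rightarrow> real ^ 'n ^ 'n \<Rightarrow> real \<Rightarrow> bool"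
where
  "free_vibration_constraint K M \<mu> \<longleftrightarrow> psd (K - \<mu> *\<^sub>R M)"

end

theory Submission
  imports Defs
begin

text \<open>
  Both constraints are instances of one Schur complement criterion: for \<open>d > 0\<close>, the block matrix
  with rows \<open>d I, -Q\<^sup>T\<close> and \<open>-Q, S\<close> is positive semidefinite iff its Schur complement
  \<open>S - (1/d) Q Q\<^sup>T\<close> is (\<open>psd_block_matrix_iff_schur\<close>). The reason is completion of the square in
  the quadratic form at a block vector \<open>(u, v)\<close>,
  \<open>d |u|\<^sup>2 - 2 u \<bullet> Q\<^sup>T v + v \<bullet> S v = d |u - (1/d) Q\<^sup>T v|\<^sup>2 + v \<bullet> (S - (1/d) Q Q\<^sup>T) v\<close>.
  The square is nonnegative, and for each \<open>v\<close> it vanishes at \<open>u = (1/d) Q\<^sup>T v\<close>.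

  With \<open>S = K - \<omega>\<^sup>2 M\<close>, the term \<open>(1/d) Q Q\<^sup>T\<close> subtracted in the Schur complement is exactly
  \<open>\<omega>\<^sup>2\<close> times the fictitious mass \<open>(1/(\<omega>\<^sup>2 d)) Q Q\<^sup>T\<close>, which gives the first half of the theorem.
  For the second half, \<open>d = 1/\<mu>\<close> turns \<open>(1/d) Q Q\<^sup>T\<close> into \<open>\<mu> Q Q\<^sup>T\<close>, the contribution of a
  nonstructural mass \<open>Q Q\<^sup>T\<close>.
\<close>

definition block_vector :: "real ^ 'm \<Rightarrow> real ^ 'k \<Rightarrow> real ^ ('m + 'k)" where
  "block_vector u v = (\<chi> i. case i of Inl r \<Rightarrow> u $ r | Inr r \<Rightarrow> v $ r)"

lemma block_vector_nth [simp]: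
  "block_vector u v $ Inl i = u $ i" "block_vector u v $ Inr j = v $ j"
  by (simp_all add: block_vector_def)

lemma block_vector_cases:
  obtains u v where "z = block_vector u v"
proof
  show "z = block_vector (\<chi> i. z $ Inl i) (\<chi> j. z $ Inr j)"
    by (simp add: vec_eq_iff block_vector_def split: sum.split)
qed

lemma sum_UNIV_Plus:
  fixes f :: "'a::finite + 'b::finite \<Rightarrow> 'c::comm_monoid_add"
  shows "sum f UNIV = (\<Sum>i\<in>UNIV. f (Inl i)) + (\<Sum>j\<in>UNIV. f (Inr j))"
  by (simp add: UNIV_Plus_UNIV [symmetric] sum.Plus comp_def del: UNIV_Plus_UNIV)

lemma inner_block_vector:
  "block_vector u v \<bullet> block_vector u' v' = u \<bullet> u' + v \<bullet> v'"
  by (simp add: inner_vec_def sum_UNIV_Plus)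

lemma block_matrix_mult_block_vector:
  "block_matrix A B C D *v block_vector u v = block_vector (A *v u + B *v v) (C *v u + D *v v)"
  by (simp add: vec_eq_iff block_matrix_def block_vector_def matrix_vector_mult_def sum_UNIV_Plus
      split: sum.split)

lemma transpose_block_matrix:
  "transpose (block_matrix A B C D) =
    block_matrix (transpose A) (transpose C) (transpose B) (transpose D)"
  by (simp add: vec_eq_iff block_matrix_def transpose_def split: sum.split)

lemma block_matrix_eq_iff:
  "block_matrix A B C D = block_matrix A' B' C' D' \<longleftrightarrow> A = A' \<and> B = B' \<and> C = C' \<and> D = D'"
  (is "?L \<longleftrightarrow> ?R")
proof
  assume ?L
  then have entry: "block_matrix A B C D $ i $ j = block_matrix A' B' C' D' $ i $ j" for i j
    by simp
  show ?R
    using entry [of "Inl _" "Inl _"] entry [of "Inl _" "Inr _"]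
      entry [of "Inr _" "Inl _"] entry [of "Inr _" "Inr _"]
    by (simp add: block_matrix_def vec_eq_iff)
qed simp

lemma transpose_uminus: "transpose (- A) = - transpose A"
  for A :: "real ^ 'n ^ 'm"
  by (simp add: vec_eq_iff transpose_def)

lemma transpose_diff: "transpose (A - B) = transpose A - transpose B"
  for A B :: "real ^ 'n ^ 'm"
  by (simp add: vec_eq_iff transpose_def)

lemma symmetric_gram: "transpose (Q ** transpose Q) = Q ** transpose Q"
  for Q :: "real ^ 'q ^ 'n"
  by (simp add: matrix_transpose_mul)

lemma uminus_matrix_vector_mult: "(- A) *v x = - (A *v x)"
  for A :: "real ^ 'n ^ 'm"
  by (simp add: vec_eq_iff matrix_vector_mult_def sum_negf)

lemma inner_gram: "v \<bullet> ((Q ** transpose Q) *v v) = (transpose Q *v v) \<bullet> (transpose Q *v v)"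
  for Q :: "real ^ 'q ^ 'n"
  by (simp add: dot_lmul_matrix [symmetric] matrix_vector_mul_assoc [symmetric])

text \<open>Completing the square in \<open>u\<close> splits the quadratic form of the block matrix into a square
  and the quadratic form of the Schur complement, which depends on \<open>v\<close> alone.\<close>

lemma block_quadratic_form:
  fixes Q :: "real ^ 'q ^ 'n" and S :: "real ^ 'n ^ 'n"
  assumes "d \<noteq> 0"
  defines "w \<equiv> \<lambda>v. (1 / d) *\<^sub>R (transpose Q *v v)"
  shows "block_vector u v \<bullet>
      (block_matrix (d *\<^sub>R mat 1) (- transpose Q) (- Q) S *v block_vector u v) =
    d * ((u - w v) \<bullet> (u - w v)) + v \<bullet> ((S - (1 / d) *\<^sub>R (Q ** transpose Q)) *v v)"
proof -
  have "v \<bullet> (Q *v u) = u \<bullet> (transpose Q *v v)"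
    by (simp add: dot_lmul_matrix [symmetric] inner_commute)
  moreover have schur_form: "v \<bullet> ((S - (1 / d) *\<^sub>R (Q ** transpose Q)) *v v) =
      v \<bullet> (S *v v) - (1 / d) * ((transpose Q *v v) \<bullet> (transpose Q *v v))"
    by (simp add: matrix_vector_mult_diff_rdistrib scaleR_matrix_vector_assoc [symmetric]
        inner_diff_right inner_gram)
  ultimately show ?thesis
    unfolding schur_form using \<open>d \<noteq> 0\<close>
    by (simp add: w_def block_matrix_mult_block_vector inner_block_vector
        uminus_matrix_vector_mult scaleR_matrix_vector_assoc [symmetric]
        inner_add_right inner_diff_left inner_diff_right inner_commute field_simps)
qed

text \<open>The off-diagonal blocks are transposes of each other and \<open>Q Q\<^sup>T\<close> is symmetric, so on each
  side symmetry amounts to that of \<open>S\<close>. Nonnegativity transfers by \<open>block_quadratic_form\<close>.\<close>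

lemma psd_block_matrix_iff_schur:
  fixes Q :: "real ^ 'q ^ 'n" and S :: "real ^ 'n ^ 'n"
  assumes "d > 0"
  shows "psd (block_matrix (d *\<^sub>R mat 1) (- transpose Q) (- Q) S) \<longleftrightarrow>
    psd (S - (1 / d) *\<^sub>R (Q ** transpose Q))"
    (is "psd ?B \<longleftrightarrow> psd ?C")
proof -
  have "transpose ?B = ?B \<longleftrightarrow> transpose S = S"
    by (simp add: transpose_block_matrix block_matrix_eq_iff transpose_uminus transpose_scalar)
  also have "\<dots> \<longleftrightarrow> transpose ?C = ?C"
    by (simp add: transpose_diff transpose_scalar symmetric_gram)
  finally have symmetric: "transpose ?B = ?B \<longleftrightarrow> transpose ?C = ?C" .
  have "(\<forall>z. 0 \<le> z \<bullet> (?B *v z)) \<longleftrightarrow> (\<forall>v. 0 \<le> v \<bullet> (?C *v v))"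
  proof (intro iffI allI)
    fix v
    assume nonneg: "\<forall>z. 0 \<le> z \<bullet> (?B *v z)"
    \<comment> \<open>This choice of the upper block makes the square vanish.\<close>
    let ?z = "block_vector ((1 / d) *\<^sub>R (transpose Q *v v)) v"
    have "?z \<bullet> (?B *v ?z) = v \<bullet> (?C *v v)"
      using \<open>d > 0\<close> by (subst block_quadratic_form) simp_all
    then show "0 \<le> v \<bullet> (?C *v v)"
      using nonneg by metis
  next
    fix z :: "real ^ ('q + 'n)"
    assume nonneg: "\<forall>v. 0 \<le> v \<bullet> (?C *v v)"
    obtain u v where "z = block_vector u v"
      by (rule block_vector_cases)
    then show "0 \<le> z \<bullet> (?B *v z)"
      using \<open>d > 0\<close> nonneg by (simp add: block_quadratic_form)
  qed
  with symmetric show ?thesis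
    by (simp add: psd_def)
qed

theorem proposition3:
  fixes K1 K2 K3 M1 :: "'e::finite \<Rightarrow> real ^ 'n ^ 'n"
    and M0 :: "real ^ 'n ^ 'n"
  assumes "\<And>e. psd (K1 e)" and "\<And>e. psd (K2 e)" and "\<And>e. psd (K3 e)"
    and "psd M0" and "\<And>e. psd (M1 e)"
  shows
    "(\<forall>\<omega> d \<mu>. \<forall>Q :: real ^ 'q ^ 'n. \<forall>Mt0.
        \<omega> > 0 \<and> d > 0 \<and> \<mu> = \<omega>\<^sup>2 \<and> Mt0 = M0 + (1 / (\<omega>\<^sup>2 * d)) *\<^sub>R (Q ** transpose Q) \<longrightarrow>
        (\<forall>a :: real ^ 'e. (\<forall>e. 0 \<le> a $ e) \<longrightarrow>
          (psd (robust_compliance_matrix (stiffness K1 K2 K3 a) (mass M0 M1 a) \<omega> Q d) \<longleftrightarrow>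
           psd (stiffness K1 K2 K3 a - \<mu> *\<^sub>R (Mt0 + (\<Sum>e\<in>UNIV. (a $ e) *\<^sub>R M1 e))))))
     \<and>
     (\<forall>\<mu>. \<forall>Qh :: real ^ 'q ^ 'n.
        \<mu> > 0 \<and> M0 = Qh ** transpose Qh \<longrightarrow>
        (\<forall>a :: real ^ 'e. (\<forall>e. 0 \<le> a $ e) \<longrightarrow>
          (let B = block_matrix ((1 / \<mu>) *\<^sub>R mat 1) (- transpose Qh) (- Qh)
                     (stiffness K1 K2 K3 a - \<mu> *\<^sub>R (\<Sum>e\<in>UNIV. (a $ e) *\<^sub>R M1 e))
           in (free_vibration_constraint (stiffness K1 K2 K3 a) (mass M0 M1 a) \<mu> \<longleftrightarrow> psd B)
            \<and> B = robust_compliance_matrix (stiffness K1 K2 K3 a) (mass 0 M1 a)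
                    (sqrt \<mu>) Qh (1 / \<mu>))))"
proof (intro conjI allI impI)
  fix \<omega> d \<mu> :: real and Q :: "real ^ 'q ^ 'n" and Mt0 and a :: "real ^ 'e"
  assume *: "\<omega> > 0 \<and> d > 0 \<and> \<mu> = \<omega>\<^sup>2 \<and> Mt0 = M0 + (1 / (\<omega>\<^sup>2 * d)) *\<^sub>R (Q ** transpose Q)"
  let ?K = "stiffness K1 K2 K3 a" and ?M = "\<Sum>e\<in>UNIV. (a $ e) *\<^sub>R M1 e"
  have "psd (robust_compliance_matrix ?K (mass M0 M1 a) \<omega> Q d) \<longleftrightarrow>
      psd (?K - \<omega>\<^sup>2 *\<^sub>R mass M0 M1 a - (1 / d) *\<^sub>R (Q ** transpose Q))"
    using * by (simp add: robust_compliance_matrix_def psd_block_matrix_iff_schur)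
  also have "?K - \<omega>\<^sup>2 *\<^sub>R mass M0 M1 a - (1 / d) *\<^sub>R (Q ** transpose Q) = ?K - \<mu> *\<^sub>R (Mt0 + ?M)"
  proof -
    have "\<mu> *\<^sub>R (1 / (\<omega>\<^sup>2 * d)) *\<^sub>R (Q ** transpose Q) = (1 / d) *\<^sub>R (Q ** transpose Q)"
      using * by simp
    then show ?thesis
      using * by (simp add: mass_def scaleR_add_right)
  qed
  finally show "psd (robust_compliance_matrix ?K (mass M0 M1 a) \<omega> Q d) \<longleftrightarrow>
      psd (?K - \<mu> *\<^sub>R (Mt0 + ?M))" .
next
  fix \<mu> :: real and Qh :: "real ^ 'q ^ 'n" and a :: "real ^ 'e"
  assume *: "\<mu> > 0 \<and> M0 = Qh ** transpose Qh"
  let ?K = "stiffness K1 K2 K3 a" and ?M = "\<Sum>e\<in>UNIV. (a $ e) *\<^sub>R M1 e"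
  let ?B = "block_matrix ((1 / \<mu>) *\<^sub>R mat 1) (- transpose Qh) (- Qh) (?K - \<mu> *\<^sub>R ?M)"
  have "psd ?B \<longleftrightarrow> psd (?K - \<mu> *\<^sub>R ?M - (1 / (1 / \<mu>)) *\<^sub>R (Qh ** transpose Qh))"
    using * by (intro psd_block_matrix_iff_schur) simp
  also have "?K - \<mu> *\<^sub>R ?M - (1 / (1 / \<mu>)) *\<^sub>R (Qh ** transpose Qh) = ?K - \<mu> *\<^sub>R mass M0 M1 a"
    using * by (simp add: mass_def algebra_simps)
  finally have "free_vibration_constraint ?K (mass M0 M1 a) \<mu> \<longleftrightarrow> psd ?B"
    by (simp add: free_vibration_constraint_def)
  moreover have "?B = robust_compliance_matrix ?K (mass 0 M1 a) (sqrt \<mu>) Qh (1 / \<mu>)"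
    using * by (simp add: robust_compliance_matrix_def mass_def)
  ultimately show "let B = ?B in
      (free_vibration_constraint ?K (mass M0 M1 a) \<mu> \<longleftrightarrow> psd B) \<and>
      B = robust_compliance_matrix ?K (mass 0 M1 a) (sqrt \<mu>) Qh (1 / \<mu>)"
    by (simp add: Let_def)
qed

end
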